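(* Let $p\ge2$ be an integer and let $(x_{ij})_{1\le i\ne j\le p}$ be real numbers in $[0,1]$ with $x_{ij}=x_{ji}$ for all $i\neq j$. For a permutation $\tau\in\mathcal S_p$ and $2\le i\le p$ define $X_i(\tau)=\max_{j<i}x_{\tau(j)\tau(i)}$, and set $$S_*(\tau)=\frac1{p-1}\sum_{i=2}^pX_i(\tau).$$ Then there exists $\tau\in\mathcal S_p$ such that $$S_*(\tau)\ \ge\ \frac{\dfrac{2}{p(p-1)}\displaystyle\sum_{1\le i\ne j\le p}x_{ij}^2}{1+\dfrac1{p(p-1)}\displaystyle\sum_{1\le i\ne j\le p}x_{ij}^2}.$$
   Context: $\mathcal S_p$ is the group of permutations of $\{1,\dots,p\}$. Sums over $1\le i\ne j\le p$ run over ordered pairs $(i,j)$ with $i\neq j$. *)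

theory Defs
  imports Complex_Main "HOL-Combinatorics.Permutations"
begin

(* The Max is over a nonempty set only for i >= 2, the only case that S_star uses. *)
definition X_max :: "(nat \<Rightarrow> nat \<Rightarrow> real) \<Rightarrow> (nat \<Rightarrow> nat) \<Rightarrow> nat \<Rightarrow> real" where
  "X_max x \<tau> i = Max ((\<lambda>j. x (\<tau> j) (\<tau> i)) ` {1..<i})"

definition S_star :: "nat \<Rightarrow> (nat \<Rightarrow> nat \<Rightarrow> real) \<Rightarrow> (nat \<Rightarrow> nat) \<Rightarrow> real" where
  "S_star p x \<tau> = 1 / (real p - 1) * (\<Sum>i=2..p. X_max x \<tau> i)"

definition distinct_pairs :: "nat \<Rightarrow> (nat \<times> nat) set" where
  "distinct_pairs p = {(i, j) \<in> {1..p} \<times> {1..p}. i \<noteq> j}"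

end

(* Build tau greedily, as in Prim's algorithm: position k receives the unused index with the
   heaviest edge to the indices placed before.  Writing a k for X_k(tau), an edge between
   positions j < i crosses both the cut before position j + 1 and the cut before position i,
   so its weight is at most min (a (j + 1)) (a i).  The sum of the squared weights is thus
   bounded by a symmetric function of the a k alone, and the resulting inequality for
   finite families in [0, 1] follows by induction, removing a smallest member. *)

theory Submission
  imports Defs
begin

definition greedy_upto :: "nat \<Rightarrow> (nat \<Rightarrow> nat \<Rightarrow> real) \<Rightarrow> nat \<Rightarrow> (nat \<Rightarrow> nat) \<Rightarrow> bool" where
  "greedy_upto p x m \<tau> \<longleftrightarrow>
    (\<forall>k\<in>{2..m}. \<forall>j\<in>{1..<k}. \<forall>i\<in>{k..p}. x (\<tau> j) (\<tau> i) \<le> X_max x \<tau> k)"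

lemma X_max_ge:
  assumes "j \<in> {1..<i}"
  shows "x (\<tau> j) (\<tau> i) \<le> X_max x \<tau> i"
  unfolding X_max_def using assms by (intro Max_ge) auto

lemma X_max_in:
  assumes "2 \<le> i"
  shows "\<exists>j\<in>{1..<i}. X_max x \<tau> i = x (\<tau> j) (\<tau> i)"
proof -
  have "X_max x \<tau> i \<in> (\<lambda>j. x (\<tau> j) (\<tau> i)) ` {1..<i}"
    unfolding X_max_def using assms by (intro Max_in) auto
  then show ?thesis by auto
qed

text \<open>Among the edges across the cut between positions up to \<open>m\<close> and the rest,
  take a heaviest one and swap its far end into position \<open>Suc m\<close>. The swap fixes the
  positions up to \<open>m\<close> and permutes the others, so every earlier cut keeps its edges and
  its value of \<open>X_max\<close>.\<close>

lemma greedy_upto_Suc: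
  assumes perm: "\<tau> permutes {1..p}" and greedy: "greedy_upto p x m \<tau>"
    and m: "1 \<le> m" "m < p"
  shows "\<exists>\<tau>'. \<tau>' permutes {1..p} \<and> greedy_upto p x (Suc m) \<tau>'"
proof -
  let ?f = "\<lambda>(j, i). x (\<tau> j) (\<tau> i)"
  let ?C = "{1..m} \<times> {Suc m..p}"
  have C: "finite ?C" "?C \<noteq> {}" using m by auto
  have "Max (?f ` ?C) \<in> ?f ` ?C" using C by (intro Max_in) auto
  then obtain b c where b: "b \<in> {1..m}" and c: "c \<in> {Suc m..p}"
    and bc: "Max (?f ` ?C) = x (\<tau> b) (\<tau> c)" by auto
  have heaviest: "x (\<tau> j) (\<tau> i) \<le> x (\<tau> b) (\<tau> c)"
    if "j \<in> {1..m}" "i \<in> {Suc m..p}" for i j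
    unfolding bc[symmetric] using that C by (intro Max_ge) auto
  let ?t = "transpose (Suc m) c"
  let ?\<tau>' = "\<tau> \<circ> ?t"
  have low: "?t j = j" if "j \<le> m" for j
    using that c by (auto simp: transpose_def)
  have high: "?t i \<in> {k..p}" if "i \<in> {k..p}" "k \<le> Suc m" for i k
    using that c m by (auto simp: transpose_def)
  have "?\<tau>' permutes {1..p}"
    using c m by (intro permutes_compose[OF permutes_swap_id perm]) auto
  moreover have "greedy_upto p x (Suc m) ?\<tau>'"
    unfolding greedy_upto_def
  proof (intro ballI)
    fix k j i assume k: "k \<in> {2..Suc m}" and j: "j \<in> {1..<k}" and i: "i \<in> {k..p}"
    have i': "?t i \<in> {k..p}" using high i k by auto
    have j': "?t j = j" using low j k by auto
    show "x (?\<tau>' j) (?\<tau>' i) \<le> X_max x ?\<tau>' k"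
    proof (cases "k = Suc m")
      case True
      \<comment> \<open>Position \<open>Suc m\<close> now holds \<open>\<tau> c\<close>, so the
        heaviest crossing weight is one of the values over which \<open>X_max\<close> is taken
        there.\<close>
      have "x (?\<tau>' j) (?\<tau>' i) \<le> x (\<tau> b) (\<tau> c)"
        using heaviest[of j "?t i"] i' j j' True by auto
      also have "\<dots> = x (?\<tau>' b) (?\<tau>' k)" using True b low by auto
      also have "\<dots> \<le> X_max x ?\<tau>' k" using X_max_ge[of b k x ?\<tau>'] b True by auto
      finally show ?thesis .
    next
      case False
      then have km: "k \<in> {2..m}" using k by auto
      have "X_max x ?\<tau>' k = X_max x \<tau> k"
        unfolding X_max_def using low km by (intro arg_cong[where f = Max] image_cong) auto
      then show ?thesis using greedy km j i' j' unfolding greedy_upto_def by auto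
    qed
  qed
  ultimately show ?thesis by blast
qed

lemma greedy_permutation:
  assumes "1 \<le> p"
  shows "\<exists>\<tau>. \<tau> permutes {1..p} \<and> greedy_upto p x p \<tau>"
proof -
  have "\<exists>\<tau>. \<tau> permutes {1..p} \<and> greedy_upto p x m \<tau>" if "1 \<le> m" "m \<le> p" for m
    using that
  proof (induction m rule: dec_induct)
    case base
    show ?case by (intro exI[of _ id] conjI permutes_id) (auto simp: greedy_upto_def)
  next
    case (step m)
    then show ?case using greedy_upto_Suc[of _ p x m] by auto
  qed
  then show ?thesis using assms by blast
qed

text \<open>This is what remains of the induction step in \<open>min_squares_le\<close> when
  \<open>m\<close> members of mean \<open>u\<close> are joined by a smallest member
  \<open>w\<close>. With \<open>v = 1 - u\<close>, right side minus left side is twice the sum of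
  two terms: \<open>m * (u * v + w - (w * (1 + v))\<^sup>2)\<close> and
  \<open>(1 + v) * w * (1 - w * (2 - w))\<close>. Both are nonnegative.\<close>

lemma min_squares_step:
  fixes m u w :: real
  assumes "0 \<le> m" "0 \<le> w" "w \<le> u" "u \<le> 1"
  shows "m * u * (2 * (m + 1) - m * u - w) + 2 * w\<^sup>2 * (2 - u) * (2 * (m + 1) - m * u - w)
    \<le> (m + 2) * (m * u + w) * (2 - u)"
proof -
  define v where "v = 1 - u"
  have u: "u = 1 - v" and v: "0 \<le> v" using assms by (auto simp: v_def)
  have w2: "w * (2 - w) \<le> 1"
    using zero_le_power2[of "1 - w"] by (simp add: power2_eq_square algebra_simps)
  \<comment> \<open>A number in [0, 1] dominates its square, so the bound on
    \<open>w * (1 + v)\<close> reduces the first term to \<open>w * v \<le> u * v\<close>.\<close>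
  have "w * (1 + v) \<le> (1 - v) * (1 + v)" using assms v u by (intro mult_right_mono) auto
  also have "\<dots> \<le> 1" by (simp add: algebra_simps)
  finally have wv: "w * (1 + v) \<le> 1" .
  have "(w * (1 + v)) * (w * (1 + v)) \<le> w * (1 + v)"
    using mult_left_mono[OF wv, of "w * (1 + v)"] assms v by simp
  also have "\<dots> \<le> u * v + w" using mult_right_mono[OF \<open>w \<le> u\<close> v] by (simp add: algebra_simps)
  finally have "0 \<le> m * (u * v + w - (w * (1 + v)) * (w * (1 + v)))"
    using assms by simp
  moreover have "0 \<le> (1 + v) * w * (1 - w * (2 - w))"
    using w2 v assms by (intro mult_nonneg_nonneg) auto
  ultimately show ?thesis unfolding u by (simp add: power2_eq_square algebra_simps)
qed

lemma min_squares_le: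
  fixes a :: "'a \<Rightarrow> real"
  assumes "finite A" "\<And>k. k \<in> A \<Longrightarrow> a k \<in> {0..1}"
  shows "((\<Sum>k\<in>A. \<Sum>l\<in>A. (min (a k) (a l))\<^sup>2) + (\<Sum>k\<in>A. (a k)\<^sup>2)) * (2 * real (card A) - sum a A)
    \<le> real (card A) * (real (card A) + 1) * sum a A"
  using assms
\<comment> \<open>Ranking by \<open>- a k\<close> makes each inserted \<open>z\<close> a smallest
  member. The rule allows \<open>z\<close> to be in \<open>A\<close> already, hence the case
  split.\<close>
proof (induction A rule: finite_ranking_induct[where f = "\<lambda>k. - a k"])
  case empty
  show ?case by simp
next
  case (insert z A)
  show ?case
  proof (cases "z \<in> A")
    case True
    then show ?thesis using insert by (simp add: insert_absorb)
  next
    case False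
    define m where "m = real (card A)"
    define w where "w = a z"
    define U where "U = sum a A"
    define G where "G = (\<Sum>k\<in>A. \<Sum>l\<in>A. (min (a k) (a l))\<^sup>2) + (\<Sum>k\<in>A. (a k)\<^sup>2)"
    have w: "0 \<le> w" "w \<le> 1" using insert.prems[of z] by (auto simp: w_def)
    have wA: "w \<le> a y" if "y \<in> A" for y using insert.hyps(2)[OF that] by (simp add: w_def)
    have IH: "G * (2 * m - U) \<le> m * (m + 1) * U"
      using insert by (simp add: G_def m_def U_def)
    have mz: "(\<Sum>l\<in>A. (min (a z) (a l))\<^sup>2) = m * w\<^sup>2" "(\<Sum>l\<in>A. (min (a l) (a z))\<^sup>2) = m * w\<^sup>2"
      using wA by (simp_all add: m_def w_def min_absorb1 min_absorb2)
    \<comment> \<open>Every minimum involving \<open>z\<close> equals \<open>w\<close>: the new row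
      and column give \<open>2 * m + 1\<close> copies of its square, and the diagonal sum gives one
      more.\<close>
    have G': "(\<Sum>k\<in>insert z A. \<Sum>l\<in>insert z A. (min (a k) (a l))\<^sup>2) + (\<Sum>k\<in>insert z A. (a k)\<^sup>2)
      = G + 2 * (m + 1) * w\<^sup>2"
      using insert.hyps False mz by (simp add: sum.distrib G_def w_def algebra_simps)
    have "(G + 2 * (m + 1) * w\<^sup>2) * (2 * (m + 1) - (U + w)) \<le> (m + 1) * (m + 1 + 1) * (U + w)"
    \<comment> \<open>Without members there is no mean \<open>u\<close>; the claim is then just
      \<open>w * (2 - w) \<le> 1\<close>, multiplied by \<open>2 * w\<close>.\<close>
    proof (cases "A = {}")
      case True
      then have "m = 0" "U = 0" "G = 0" by (simp_all add: m_def U_def G_def)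
      then show ?thesis using min_squares_step[of 0 w w] w
        mult_left_mono[of "w * (2 - w)" 1 "2 * w"] zero_le_power2[of "1 - w"]
        by (simp add: power2_eq_square algebra_simps)
    next
      case ne: False
      then have m: "m > 0" using insert.hyps by (simp add: m_def card_gt_0_iff)
      define u where "u = U / m"
      have U: "U = m * u" using m by (simp add: u_def)
      have "m * w \<le> U" using sum_bounded_below[of A w a] wA by (simp add: m_def U_def)
      then have wu: "w \<le> u" using m by (simp add: U)
      have "U \<le> m" using sum_bounded_above[of A a 1] insert.prems by (simp add: m_def U_def)
      then have u1: "u \<le> 1" using m by (simp add: U)
      define D where "D = 2 * (m + 1) - m * u - w"
      have "U + w \<le> m + 1" using \<open>U \<le> m\<close> w by (intro add_mono)
      also have "\<dots> \<le> 2 * (m + 1)" using m by simp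
      finally have D: "D \<ge> 0" by (simp add: D_def U)
      have "m * (G * (2 - u)) \<le> m * ((m + 1) * (m * u))" using IH by (simp add: U algebra_simps)
      then have IH': "G * (2 - u) \<le> (m + 1) * (m * u)" using m by simp
      \<comment> \<open>The factor \<open>2 - u\<close>, positive because \<open>u \<le> 1\<close>,
        lets \<open>IH'\<close> replace \<open>G\<close>; it is cancelled at the end.\<close>
      have "(G + 2 * (m + 1) * w\<^sup>2) * D * (2 - u)
        = G * (2 - u) * D + (m + 1) * (2 * w\<^sup>2 * (2 - u) * D)"
        by (simp add: algebra_simps)
      also have "\<dots> \<le> (m + 1) * (m * u) * D + (m + 1) * (2 * w\<^sup>2 * (2 - u) * D)"
        using mult_right_mono[OF IH' D] by simp
      also have "\<dots> = (m + 1) * (m * u * D + 2 * w\<^sup>2 * (2 - u) * D)"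
        by (simp add: algebra_simps)
      also have "\<dots> \<le> (m + 1) * ((m + 2) * (m * u + w) * (2 - u))"
        using min_squares_step[of m w u] m w wu u1
        by (intro mult_left_mono) (auto simp: D_def)
      finally have "(G + 2 * (m + 1) * w\<^sup>2) * D * (2 - u)
        \<le> (m + 1) * (m + 2) * (m * u + w) * (2 - u)" by (simp only: mult.assoc)
      then have "(G + 2 * (m + 1) * w\<^sup>2) * D \<le> (m + 1) * (m + 2) * (m * u + w)"
        using u1 by (simp add: mult_le_cancel_right)
      then show ?thesis by (simp add: D_def U algebra_simps)
    qed
    moreover have "real (card (insert z A)) = m + 1" "sum a (insert z A) = U + w"
      using insert.hyps False by (simp_all add: m_def U_def w_def)
    ultimately show ?thesis unfolding G' by simp
  qed
qed

lemma sum_distinct_pairs_symmetric: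
  fixes h :: "nat \<Rightarrow> nat \<Rightarrow> real"
  assumes "\<And>i j. (i, j) \<in> distinct_pairs p \<Longrightarrow> h i j = h j i"
  shows "(\<Sum>(i, j)\<in>distinct_pairs p. h i j) = 2 * (\<Sum>i\<in>{2..p}. \<Sum>j\<in>{1..<i}. h j i)"
proof -
  let ?L = "SIGMA i:{2..p}. {1..<i}"
  have "distinct_pairs p = ?L \<union> prod.swap ` ?L"
    by (force simp: distinct_pairs_def)
  moreover have "?L \<inter> prod.swap ` ?L = {}" by auto
  ultimately have "(\<Sum>(i, j)\<in>distinct_pairs p. h i j)
    = (\<Sum>(i, j)\<in>?L. h i j) + (\<Sum>(i, j)\<in>prod.swap ` ?L. h i j)"
    by (simp add: sum.union_disjoint)
  also have "(\<Sum>(i, j)\<in>?L. h i j) = (\<Sum>(i, j)\<in>?L. h j i)"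
    using assms by (intro sum.cong) (auto simp: distinct_pairs_def)
  also have "(\<Sum>(i, j)\<in>prod.swap ` ?L. h i j) = (\<Sum>(i, j)\<in>?L. h j i)"
    by (subst sum.reindex) (auto simp: case_prod_unfold)
  also have "(\<Sum>(i, j)\<in>?L. h j i) = (\<Sum>i\<in>{2..p}. \<Sum>j\<in>{1..<i}. h j i)"
    by (simp add: sum.Sigma)
  finally show ?thesis by simp
qed

text \<open>Inclusion-exclusion: the closed triangle and its mirror image cover the square and
  overlap exactly in the diagonal. This is where the extra sum of squares in
  \<open>min_squares_le\<close> comes from.\<close>

lemma sum_square_plus_diagonal:
  fixes h :: "nat \<Rightarrow> nat \<Rightarrow> real"
  assumes "\<And>k l. h k l = h l k"
  shows "(\<Sum>k\<in>{2..p}. \<Sum>l\<in>{2..p}. h k l) + (\<Sum>k\<in>{2..p}. h k k)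
    = 2 * (\<Sum>l\<in>{2..p}. \<Sum>k\<in>{2..l}. h k l)"
proof -
  let ?T = "SIGMA l:{2..p}. {2..l}"
  have un: "{2..p} \<times> {2..p} = ?T \<union> prod.swap ` ?T"
    by (force simp: image_iff)
  have int: "?T \<inter> prod.swap ` ?T = (\<lambda>k. (k, k)) ` {2..p}" by (force simp: image_iff)
  have "(\<Sum>k\<in>{2..p}. \<Sum>l\<in>{2..p}. h k l) = (\<Sum>(k, l)\<in>?T \<union> prod.swap ` ?T. h k l)"
    by (simp add: sum.cartesian_product un)
  moreover have "(\<Sum>k\<in>{2..p}. h k k) = (\<Sum>(k, l)\<in>?T \<inter> prod.swap ` ?T. h k l)"
    unfolding int by (subst sum.reindex) (auto simp: inj_on_def)
  moreover have "(\<Sum>(k, l)\<in>?T \<union> prod.swap ` ?T. h k l) + (\<Sum>(k, l)\<in>?T \<inter> prod.swap ` ?T. h k l)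
    = (\<Sum>(k, l)\<in>?T. h k l) + (\<Sum>(k, l)\<in>prod.swap ` ?T. h k l)"
    by (intro sum.union_inter) auto
  moreover have "(\<Sum>(k, l)\<in>?T. h k l) = (\<Sum>(l, k)\<in>?T. h k l)"
    using assms by (intro sum.cong) auto
  moreover have "(\<Sum>(k, l)\<in>prod.swap ` ?T. h k l) = (\<Sum>(l, k)\<in>?T. h k l)"
    by (subst sum.reindex) (auto simp: case_prod_unfold)
  moreover have "(\<Sum>(l, k)\<in>?T. h k l) = (\<Sum>l\<in>{2..p}. \<Sum>k\<in>{2..l}. h k l)"
    by (simp add: sum.Sigma)
  ultimately show ?thesis by simp
qed

lemma distinct_pairs_permutes:
  assumes "\<tau> permutes {1..p}"
  shows "(\<tau> i, \<tau> j) \<in> distinct_pairs p \<longleftrightarrow> (i, j) \<in> distinct_pairs p"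
  using permutes_in_image[OF assms] permutes_inj[OF assms, THEN inj_eq]
  by (auto simp: distinct_pairs_def simp del: atLeastAtMost_iff)

lemma sum_distinct_pairs_permutes:
  assumes "\<tau> permutes {1..p}"
  shows "(\<Sum>(i, j)\<in>distinct_pairs p. h (\<tau> i) (\<tau> j)) = (\<Sum>(i, j)\<in>distinct_pairs p. h i j)"
proof -
  let ?g = "\<lambda>\<sigma>. \<lambda>(i, j). (\<sigma> i, \<sigma> j)"
  have inv: "inv \<tau> permutes {1..p}" using assms by (rule permutes_inv)
  show ?thesis
    by (rule sum.reindex_bij_witness[of _ "?g (inv \<tau>)" "?g \<tau>"])
      (auto simp: permutes_inverses[OF assms] distinct_pairs_permutes[OF assms]
        distinct_pairs_permutes[OF inv])
qed

lemma greedy_sum_squares_le: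
  fixes x :: "nat \<Rightarrow> nat \<Rightarrow> real"
  assumes perm: "\<tau> permutes {1..p}" and greedy: "greedy_upto p x p \<tau>"
    and nonneg: "\<And>i j. (i, j) \<in> distinct_pairs p \<Longrightarrow> 0 \<le> x i j"
    and sym: "\<And>i j. (i, j) \<in> distinct_pairs p \<Longrightarrow> x i j = x j i"
  defines "a \<equiv> X_max x \<tau>"
  shows "(\<Sum>(i, j)\<in>distinct_pairs p. (x i j)\<^sup>2)
    \<le> (\<Sum>k\<in>{2..p}. \<Sum>l\<in>{2..p}. (min (a k) (a l))\<^sup>2) + (\<Sum>k\<in>{2..p}. (a k)\<^sup>2)"
proof -
  let ?y = "\<lambda>i j. x (\<tau> i) (\<tau> j)"
  \<comment> \<open>Relabelling by \<open>\<tau>\<close> turns indices into positions, where the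
    cuts live.\<close>
  have "(\<Sum>(i, j)\<in>distinct_pairs p. (x i j)\<^sup>2) = (\<Sum>(i, j)\<in>distinct_pairs p. (?y i j)\<^sup>2)"
    using sum_distinct_pairs_permutes[OF perm, of "\<lambda>i j. (x i j)\<^sup>2"] by simp
  also have "\<dots> = 2 * (\<Sum>i\<in>{2..p}. \<Sum>j\<in>{1..<i}. (?y j i)\<^sup>2)"
    using sym distinct_pairs_permutes[OF perm]
    by (intro sum_distinct_pairs_symmetric) (metis (mono_tags))
  also have "\<dots> \<le> 2 * (\<Sum>i\<in>{2..p}. \<Sum>j\<in>{1..<i}. (min (a (Suc j)) (a i))\<^sup>2)"
  proof (intro mult_left_mono sum_mono power_mono)
    fix i j assume ij: "i \<in> {2..p}" "j \<in> {1..<i}"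
    then show "?y j i \<le> min (a (Suc j)) (a i)"
      using greedy unfolding greedy_upto_def a_def by auto
    have "(j, i) \<in> distinct_pairs p" using ij by (auto simp: distinct_pairs_def)
    then show "0 \<le> ?y j i" using nonneg distinct_pairs_permutes[OF perm] by blast
  qed simp
  \<comment> \<open>The shift \<open>k = Suc j\<close> turns the strict triangle
    \<open>j < i\<close> into the closed one \<open>k \<le> i\<close>; adjacent positions land on
    the diagonal.\<close>
  also have "(\<Sum>i\<in>{2..p}. \<Sum>j\<in>{1..<i}. (min (a (Suc j)) (a i))\<^sup>2)
    = (\<Sum>i\<in>{2..p}. \<Sum>k\<in>{2..i}. (min (a k) (a i))\<^sup>2)"
    by (intro sum.cong refl sum.reindex_bij_witness[of _ "\<lambda>k. k - 1" Suc]) auto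
  also have "2 * \<dots> = (\<Sum>k\<in>{2..p}. \<Sum>l\<in>{2..p}. (min (a k) (a l))\<^sup>2) + (\<Sum>k\<in>{2..p}. (a k)\<^sup>2)"
    using sum_square_plus_diagonal[of "\<lambda>k l. (min (a k) (a l))\<^sup>2" p]
    by (simp add: min.commute)
  finally show ?thesis .
qed

theorem theoremJ1:
  fixes p :: nat and x :: "nat \<Rightarrow> nat \<Rightarrow> real"
  assumes "p \<ge> 2"
    and "\<And>i j. (i, j) \<in> distinct_pairs p \<Longrightarrow> x i j \<in> {0..1}"
    and "\<And>i j. (i, j) \<in> distinct_pairs p \<Longrightarrow> x i j = x j i"
  shows "\<exists>\<tau>. \<tau> permutes {1..p} \<and>
    S_star p x \<tau> \<ge>
      (2 / (real p * (real p - 1)) * (\<Sum>(i, j)\<in>distinct_pairs p. (x i j)\<^sup>2)) /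
      (1 + 1 / (real p * (real p - 1)) * (\<Sum>(i, j)\<in>distinct_pairs p. (x i j)\<^sup>2))"
proof -
  obtain \<tau> where perm: "\<tau> permutes {1..p}" and greedy: "greedy_upto p x p \<tau>"
    using greedy_permutation[of p x] assms(1) by auto
  define a where "a = X_max x \<tau>"
  define n where "n = real p - 1"
  define S where "S = sum a {2..p}"
  define Q where "Q = (\<Sum>(i, j)\<in>distinct_pairs p. (x i j)\<^sup>2)"
  have n: "n > 0" "real (card {2..p}) = n" using assms(1) by (auto simp: n_def)
  have Q: "Q \<ge> 0" unfolding Q_def by (intro sum_nonneg) auto
  have a: "a k \<in> {0..1}" if k: "k \<in> {2..p}" for k
  proof -
    obtain j where j: "j \<in> {1..<k}" "a k = x (\<tau> j) (\<tau> k)"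
      using X_max_in[of k x \<tau>] k by (auto simp: a_def)
    have "(j, k) \<in> distinct_pairs p" using j k by (auto simp: distinct_pairs_def)
    then have "(\<tau> j, \<tau> k) \<in> distinct_pairs p" by (simp add: distinct_pairs_permutes[OF perm])
    then show ?thesis using assms(2) j by auto
  qed
  \<comment> \<open>This makes \<open>2 * n - S\<close> nonnegative, so the bound on
    \<open>Q\<close> may be multiplied by it.\<close>
  have "S \<le> n" using sum_bounded_above[of "{2..p}" a 1] a n by (simp add: S_def)
  then have "Q * (2 * n - S) \<le> ((\<Sum>k\<in>{2..p}. \<Sum>l\<in>{2..p}. (min (a k) (a l))\<^sup>2)
      + (\<Sum>k\<in>{2..p}. (a k)\<^sup>2)) * (2 * n - S)"
    using greedy_sum_squares_le[OF perm greedy] assms(2,3) n unfolding Q_def a_def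
    by (intro mult_right_mono) auto
  also have "\<dots> \<le> n * (n + 1) * S"
    using min_squares_le[of "{2..p}" a] a n by (simp add: S_def)
  finally have main: "Q * (2 * n - S) \<le> n * (n + 1) * S" .
  have p: "real p = n + 1" by (simp add: n_def)
  define c where "c = n * (n + 1)"
  have c: "c > 0" using n by (simp add: c_def)
  have "(2 / c * Q) / (1 + 1 / c * Q) = 2 * Q / (c + Q)"
    using c Q by (simp add: field_simps)
  \<comment> \<open>After clearing denominators this reads
    \<open>2 * n * Q \<le> S * (c + Q)\<close>, which is \<open>main\<close> with the term
    \<open>Q * S\<close> moved across.\<close>
  also have "\<dots> \<le> S / n"
    using main c Q n by (simp add: c_def field_simps)
  finally have "(2 / c * Q) / (1 + 1 / c * Q) \<le> S_star p x \<tau>"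
    by (simp add: S_star_def S_def a_def p)
  then show ?thesis
    using perm by (intro exI[of _ \<tau>]) (simp add: Q_def c_def p mult.commute)
qed

end
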